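(* Let $G$ be a graph and let $k\geq \ell\geq 1$ be integers. Assume that in each connected component of $G$ all blocks but one are ideally $[\ell,k]$-choosable (resp. ideally $\ell$-choosable) and the remaining block is $[\ell,k]$-choosable (resp. $\ell$-choosable). Then $G$ is $[\ell,k]$-choosable (resp. $\ell$-choosable).
   Context: All graphs are finite and simple. A graph $G=(V,E)$ is $[\ell,k]$-choosable (with $k\ge \ell$) if for every assignment of lists $L(v)\subseteq\{1,\dots,k\}$ with $|L(v)|=\ell$ for all $v\in V$, there is a list coloring, i.e. a proper coloring $c$ of $G$ with $c(v)\in L(v)$ for all $v\in V$. $G$ is $\ell$-choosable if it is $[\ell,k]$-choosable for every $k\ge\ell$. $G$ is ideally $[\ell,k]$-choosable if for every such list assignment $L$, every vertex $v_0$ and every color $c_0\in L(v_0)$ there is a list coloring of $G$ in which $v_0$ gets color $c_0$; $G$ is ideally $\ell$-choosable if it is ideally $[\ell,k]$-choosable for every $k\ge \ell$. A cut vertex of a connected graph is a vertex whose removal disconnects it; a block of a graph is a maximal connected subgraph without a cut vertex (of itself). *)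

theory Defs
  imports "Graph_Theory.Digraph_Component"
begin

text \<open>
  A finite simple graph is a symmetric digraph satisfying the locale \<open>graph\<close>: each edge is
  a pair of opposite arcs. A \<open>subgraph\<close> in the sense of the library may contain only one arc of
  such a pair, hence the requirement \<open>graph H\<close> whenever subgraphs are considered below.
\<close>

definition connected_component :: "('a,'b) pre_digraph \<Rightarrow> ('a,'b) pre_digraph \<Rightarrow> bool" where
  "connected_component G C \<longleftrightarrow>
     pre_digraph.max_subgraph G (\<lambda>H. graph H \<and> Digraph_Component.connected H) C"

text \<open>
  The library does not count the empty graph as connected, so the first inequality is needed to
  keep the only vertex of a one-vertex graph from being a cut vertex.
\<close>

definition cut_vertex :: "('a,'b) pre_digraph \<Rightarrow> 'a \<Rightarrow> bool" where
  "cut_vertex H v \<longleftrightarrow> v \<in> verts H \<and> verts (pre_digraph.del_vert H v) \<noteq> {} \<and>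
     \<not> Digraph_Component.connected (pre_digraph.del_vert H v)"

definition block :: "('a,'b) pre_digraph \<Rightarrow> ('a,'b) pre_digraph \<Rightarrow> bool" where
  "block G B \<longleftrightarrow>
     pre_digraph.max_subgraph G
       (\<lambda>H. graph H \<and> Digraph_Component.connected H \<and> (\<nexists>v. cut_vertex H v)) B"

definition proper_coloring :: "('a,'b) pre_digraph \<Rightarrow> ('a \<Rightarrow> nat) \<Rightarrow> bool" where
  "proper_coloring G c \<longleftrightarrow> (\<forall>e \<in> arcs G. c (tail G e) \<noteq> c (head G e))"

definition list_coloring ::
    "('a,'b) pre_digraph \<Rightarrow> ('a \<Rightarrow> nat set) \<Rightarrow> ('a \<Rightarrow> nat) \<Rightarrow> bool" where
  "list_coloring G L c \<longleftrightarrow> proper_coloring G c \<and> (\<forall>v \<in> verts G. c v \<in> L v)"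

definition list_assignment ::
    "('a,'b) pre_digraph \<Rightarrow> nat \<Rightarrow> nat \<Rightarrow> ('a \<Rightarrow> nat set) \<Rightarrow> bool" where
  "list_assignment G l k L \<longleftrightarrow> (\<forall>v \<in> verts G. L v \<subseteq> {1..k} \<and> card (L v) = l)"

definition lk_choosable :: "nat \<Rightarrow> nat \<Rightarrow> ('a,'b) pre_digraph \<Rightarrow> bool" where
  "lk_choosable l k G \<longleftrightarrow>
     (\<forall>L. list_assignment G l k L \<longrightarrow> (\<exists>c. list_coloring G L c))"

definition choosable :: "nat \<Rightarrow> ('a,'b) pre_digraph \<Rightarrow> bool" where
  "choosable l G \<longleftrightarrow> (\<forall>k\<ge>l. lk_choosable l k G)"

definition ideally_lk_choosable :: "nat \<Rightarrow> nat \<Rightarrow> ('a,'b) pre_digraph \<Rightarrow> bool" where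
  "ideally_lk_choosable l k G \<longleftrightarrow>
     (\<forall>L. list_assignment G l k L \<longrightarrow>
       (\<forall>v0 \<in> verts G. \<forall>c0 \<in> L v0. \<exists>c. list_coloring G L c \<and> c v0 = c0))"

definition ideally_choosable :: "nat \<Rightarrow> ('a,'b) pre_digraph \<Rightarrow> bool" where
  "ideally_choosable l G \<longleftrightarrow> (\<forall>k\<ge>l. ideally_lk_choosable l k G)"

end

theory Submission
  imports Defs
begin

text \<open>
  Induction on the number of vertices. A cut vertex \<open>v\<close> splits a connected graph into two smaller
  connected induced subgraphs that share only \<open>v\<close>. Their blocks other than \<open>{v}\<close> are blocks of the
  whole graph, so the exceptional block lies in at most one of the two parts. Color that part first,
  and extend to the other one by prescribing the color of \<open>v\<close>.
\<close>

section \<open>Separations of a graph\<close>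

text \<open>Encodes that no edge runs between \<open>S - T\<close> and \<open>T - S\<close>. The
  overlap is left open: it is empty when a disconnected graph is split and a single vertex at a cut
  vertex, so both splittings share one notion.\<close>

definition separation :: "('a,'b) pre_digraph \<Rightarrow> 'a set \<Rightarrow> 'a set \<Rightarrow> bool" where
  "separation G S T \<longleftrightarrow> S \<union> T = verts G \<and>
     (\<forall>e \<in> arcs G. tail G e \<in> S \<and> head G e \<in> S \<or> tail G e \<in> T \<and> head G e \<in> T)"

lemma separationD:
  assumes "separation G S T"
  shows "S \<union> T = verts G"
    and "e \<in> arcs G \<Longrightarrow> tail G e \<in> S \<and> head G e \<in> S \<or> tail G e \<in> T \<and> head G e \<in> T"
  using assms unfolding separation_def by simp_all

lemma separation_commute: "separation G S T \<longleftrightarrow> separation G T S"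
  unfolding separation_def by blast

lemma separation_subgraph:
  assumes "subgraph H G" "separation G S T"
  shows "separation H (S \<inter> verts H) (T \<inter> verts H)"
proof -
  have H: "tail H = tail G" "head H = head G" "verts H \<subseteq> verts G" "arcs H \<subseteq> arcs G"
    using assms(1) by (auto simp: subgraph_def compatible_def)
  have "tail G e \<in> verts H" "head G e \<in> verts H" if "e \<in> arcs H" for e
    using assms(1) that by (auto simp: subgraph_def wf_digraph_def compatible_def)
  with H(3,4) assms(2) show ?thesis unfolding separation_def H(1,2) by blast
qed

section \<open>Connectedness through closed vertex sets\<close>

text \<open>Reachability cannot leave a vertex set that no arc crosses; conversely, the vertices
  reachable from a given one form such a set. This trades walks for sets in the later connectivity
  arguments.\<close>

lemma connected_iff_closed:
  assumes "wf_digraph G"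
  shows "Digraph_Component.connected G \<longleftrightarrow> verts G \<noteq> {} \<and>
    (\<forall>X \<subseteq> verts G. X \<noteq> {} \<and> (\<forall>e \<in> arcs G. tail G e \<in> X \<longleftrightarrow> head G e \<in> X) \<longrightarrow> X = verts G)"
    (is "_ \<longleftrightarrow> _ \<and> ?closed")
proof -
  interpret wf_digraph G by fact
  interpret S: pair_wf_digraph "mk_symmetric G" ..
  \<comment> \<open>Connectedness is strong connectedness of the symmetric closure, in which every
    arc of \<open>G\<close> can be traversed both ways.\<close>
  have step: "u \<rightarrow>\<^bsub>mk_symmetric G\<^esub> w \<longleftrightarrow>
      (\<exists>e \<in> arcs G. (u, w) = (tail G e, head G e) \<or> (u, w) = (head G e, tail G e))" for u w
    by (auto simp: parcs_mk_symmetric)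
  show ?thesis
  proof (intro iffI conjI allI impI)
    assume "Digraph_Component.connected G"
    then show "verts G \<noteq> {}" by (simp add: connected_def strongly_connected_def)
  next
    fix X
    assume conn: "Digraph_Component.connected G" and X: "X \<subseteq> verts G"
      and cl: "X \<noteq> {} \<and> (\<forall>e \<in> arcs G. tail G e \<in> X \<longleftrightarrow> head G e \<in> X)"
    then obtain x where x: "x \<in> X" by blast
    have "y \<in> X" if "y \<in> verts G" for y
    proof -
      have "x \<rightarrow>\<^sup>*\<^bsub>mk_symmetric G\<^esub> y"
        using conn x X that by (auto simp: connected_def strongly_connected_def)
      then show ?thesis
        by (induction rule: S.reachable_induct) (use x cl step in auto)
    qed
    with X show "X = verts G" by blast
  next
    assume cl: "verts G \<noteq> {} \<and> ?closed"
    show "Digraph_Component.connected G"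
      unfolding connected_def
    proof (rule strongly_connectedI)
      show "verts (with_proj (mk_symmetric G)) \<noteq> {}" using cl by simp
    next
      fix u w assume u: "u \<in> verts (with_proj (mk_symmetric G))"
        and w: "w \<in> verts (with_proj (mk_symmetric G))"
      let ?X = "{y. u \<rightarrow>\<^sup>*\<^bsub>mk_symmetric G\<^esub> y}"
      have "?X \<subseteq> verts G" by (auto dest: S.reachable_in_verts)
      moreover have "u \<in> ?X" using u by simp
      moreover have "tail G e \<in> ?X \<longleftrightarrow> head G e \<in> ?X" if "e \<in> arcs G" for e
      proof -
        have "tail G e \<rightarrow>\<^bsub>mk_symmetric G\<^esub> head G e" "head G e \<rightarrow>\<^bsub>mk_symmetric G\<^esub> tail G e"
          using that step by blast+
        then show ?thesis by (auto intro: S.reachable_adj_trans)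
      qed
      ultimately have "?X = verts G" using cl by blast
      then show "u \<rightarrow>\<^sup>*\<^bsub>mk_symmetric G\<^esub> w" using w by auto
    qed
  qed
qed

lemma connected_closedD:
  assumes "wf_digraph G" "Digraph_Component.connected G" "X \<subseteq> verts G" "X \<noteq> {}"
    and "\<And>e. e \<in> arcs G \<Longrightarrow> tail G e \<in> X \<longleftrightarrow> head G e \<in> X"
  shows "X = verts G"
proof -
  have "\<forall>X \<subseteq> verts G. X \<noteq> {} \<and> (\<forall>e \<in> arcs G. tail G e \<in> X \<longleftrightarrow> head G e \<in> X) \<longrightarrow> X = verts G"
    using assms(2) unfolding connected_iff_closed[OF assms(1)] by (rule conjunct2)
  then have "X \<noteq> {} \<and> (\<forall>e \<in> arcs G. tail G e \<in> X \<longleftrightarrow> head G e \<in> X) \<longrightarrow> X = verts G"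
    using assms(3) by blast
  then show ?thesis using assms(4,5) by simp
qed

section \<open>Connected subgraphs relative to a separation\<close>

lemma connected_separation:
  assumes "wf_digraph H" "Digraph_Component.connected H" "separation H S T" "S \<inter> T = {}"
  shows "S = {} \<or> T = {}"
proof -
  have "\<forall>e \<in> arcs H. tail H e \<in> S \<longleftrightarrow> head H e \<in> S"
    using assms(3,4) unfolding separation_def by blast
  moreover have "S \<subseteq> verts H" using assms(3) unfolding separation_def by blast
  ultimately have "S = {} \<or> S = verts H"
    using assms(2) connected_iff_closed[OF assms(1)] by blast
  then show ?thesis using assms(3,4) unfolding separation_def by blast
qed

text \<open>\<open>H\<close> misses the overlap, so the separation restricted to \<open>H\<close>
  has disjoint sides, and one of them is empty.\<close>

lemma connected_subgraph_within:
  assumes "subgraph H G" "Digraph_Component.connected H" "separation G S T" "S \<inter> T \<inter> verts H = {}"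
  shows "verts H \<subseteq> S \<or> verts H \<subseteq> T"
proof -
  note sep = separation_subgraph[OF assms(1,3)]
  have "wf_digraph H" using assms(1) by blast
  from connected_separation[OF this assms(2) sep] assms(4)
  have "S \<inter> verts H = {} \<or> T \<inter> verts H = {}" by blast
  then show ?thesis using sep unfolding separation_def by blast
qed

text \<open>If \<open>v\<close> is in \<open>H\<close>, deleting it leaves a connected graph that
  avoids the overlap and therefore lies on one side; \<open>v\<close> belongs to both sides and can
  be put back.\<close>

lemma no_cut_vertex_subgraph_within:
  assumes H: "subgraph H G" "Digraph_Component.connected H" "\<nexists>v. cut_vertex H v"
    and sep: "separation G S T" "S \<inter> T = {v}"
  shows "verts H \<subseteq> S \<or> verts H \<subseteq> T"
\<comment> \<open>\<open>verts H = {v}\<close> is set apart because deleting \<open>v\<close> would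
  leave the empty graph, which is not connected.\<close>
proof (cases "v \<in> verts H \<and> verts H \<noteq> {v}")
  case True
  let ?H = "pre_digraph.del_vert H v"
  interpret H: wf_digraph H using H(1) by blast
  have "subgraph ?H H"
    by (auto simp: subgraph_def compatible_def H.del_vert_simps intro: H.wf_digraph H.wf_digraph_del_vert)
  then have "subgraph ?H G" using H(1) by (rule subgraph_trans)
  moreover have "Digraph_Component.connected ?H"
    using H(3) True by (auto simp: cut_vertex_def H.del_vert_simps)
  ultimately have "verts ?H \<subseteq> S \<or> verts ?H \<subseteq> T"
    using sep by (intro connected_subgraph_within) (auto simp: H.del_vert_simps)
  then show ?thesis using sep(2) by (auto simp: H.del_vert_simps)
next
  case False
  show ?thesis
  proof (cases "v \<in> verts H")
    case True
    with False sep(2) show ?thesis by auto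
  next
    case False
    then show ?thesis using H sep by (intro connected_subgraph_within) auto
  qed
qed

section \<open>Splitting a graph into two sides\<close>

lemma not_connected_separation:
  assumes "wf_digraph G" "verts G \<noteq> {}" "\<not> Digraph_Component.connected G"
  obtains S T where "separation G S T" "S \<inter> T = {}" "S \<noteq> {}" "T \<noteq> {}"
proof -
  interpret wf_digraph G by fact
  obtain X where X: "X \<subseteq> verts G" "X \<noteq> {}" "X \<noteq> verts G"
      "\<forall>e \<in> arcs G. tail G e \<in> X \<longleftrightarrow> head G e \<in> X"
    using assms(2,3) connected_iff_closed[OF assms(1)] by blast
  then have "separation G X (verts G - X)" by (auto simp: separation_def)
  with X that show ?thesis by blast
qed

text \<open>A splitting of \<open>G\<close> minus \<open>v\<close> into disjoint sides yields one of
  \<open>G\<close> by putting \<open>v\<close> into both. Since the old sides are nonempty, the new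
  ones are proper, as the inductions on the number of vertices require.\<close>

lemma cut_vertex_separation:
  assumes "wf_digraph G" "cut_vertex G v"
  obtains S T where "separation G S T" "S \<inter> T = {v}" "S \<subset> verts G" "T \<subset> verts G"
proof -
  interpret wf_digraph G by fact
  let ?H = "pre_digraph.del_vert G v"
  have v: "v \<in> verts G" "verts ?H \<noteq> {}" "\<not> Digraph_Component.connected ?H"
    using assms(2) by (auto simp: cut_vertex_def)
  obtain S T where ST: "separation ?H S T" "S \<inter> T = {}" "S \<noteq> {}" "T \<noteq> {}"
    using not_connected_separation[OF wf_digraph_del_vert v(2,3)] by blast
  have un: "S \<union> T = verts G - {v}"
    using ST(1) by (simp add: separation_def del_vert_simps)
  have "separation G (insert v S) (insert v T)"
    unfolding separation_def
  proof (intro conjI ballI)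
    show "insert v S \<union> insert v T = verts G" using un v(1) by blast
  next
    fix e assume e: "e \<in> arcs G"
    then have "tail G e \<in> verts G" "head G e \<in> verts G" by auto
    moreover have "tail G e \<in> S \<and> head G e \<in> S \<or> tail G e \<in> T \<and> head G e \<in> T"
      if "tail G e \<noteq> v" "head G e \<noteq> v"
      using ST(1) e that by (auto simp: separation_def del_vert_simps)
    ultimately show "tail G e \<in> insert v S \<and> head G e \<in> insert v S \<or>
        tail G e \<in> insert v T \<and> head G e \<in> insert v T"
      using un by blast
  qed
  moreover have "insert v S \<inter> insert v T = {v}" using ST(2) by blast
  moreover have "insert v S \<subset> verts G" "insert v T \<subset> verts G" using ST(2-4) un v(1) by blast+
  ultimately show ?thesis by (rule that)
qed

text \<open>A nonempty closed set \<open>X\<close> of \<open>G \<restriction> S\<close> is turned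
  into a closed set of \<open>G\<close>, which must be everything: \<open>T\<close> is added if
  \<open>v\<close> is in \<open>X\<close>, otherwise \<open>X\<close> is taken as it is.\<close>

lemma connected_induce_separation:
  assumes "wf_digraph G" "Digraph_Component.connected G" "separation G S T" "S \<inter> T = {v}"
  shows "Digraph_Component.connected (G \<restriction> S)"
proof -
  interpret wf_digraph G by fact
  note sep = separationD[OF assms(3)]
  note G = connected_closedD[OF assms(1,2)]
  have v: "v \<in> S" "v \<in> T" "\<And>x. x \<in> S \<Longrightarrow> x \<in> T \<Longrightarrow> x = v" using assms(4) by auto
  have "X = S"
    if X: "X \<subseteq> S" "X \<noteq> {}"
      and cl: "\<And>e. \<lbrakk>e \<in> arcs G; tail G e \<in> S; head G e \<in> S\<rbrakk> \<Longrightarrow> tail G e \<in> X \<longleftrightarrow> head G e \<in> X" for X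
  proof (cases "v \<in> X")
    case True
    have "tail G e \<in> X \<union> T \<longleftrightarrow> head G e \<in> X \<union> T" if "e \<in> arcs G" for e
      using sep(2)[OF that]
    proof
      assume e: "tail G e \<in> S \<and> head G e \<in> S"
      then have "tail G e \<in> X \<longleftrightarrow> head G e \<in> X" using cl[OF that] by blast
      moreover have "tail G e \<in> X" if "tail G e \<in> T" using v(3) e that True by metis
      moreover have "head G e \<in> X" if "head G e \<in> T" using v(3) e that True by metis
      ultimately show ?thesis by blast
    qed blast
    then have "X \<union> T = verts G" using X sep(1) by (intro G) auto
    then show ?thesis using X(1) sep(1) v(3) True by (metis Un_iff subsetD subset_antisym subsetI)
  next
    \<comment> \<open>Arcs inside \<open>T\<close> do not meet \<open>X\<close>, since a vertex of
      \<open>X\<close> in \<open>T\<close> could only be \<open>v\<close>. So \<open>X\<close> would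
      be all of \<open>verts G\<close> without containing \<open>v\<close>, a contradiction.\<close>
    case False
    have "tail G e \<in> X \<longleftrightarrow> head G e \<in> X" if "e \<in> arcs G" for e
      using sep(2)[OF that] cl[OF that] False X(1) v(3) by (metis subsetD)
    then have "X = verts G" using X sep(1) by (intro G) auto
    then show ?thesis using False sep(1) v(1) by auto
  qed
  moreover have "S \<noteq> {}" using assms(4) by blast
  moreover have "wf_digraph (G \<restriction> S)" by (rule wellformed_induce_subgraph)
  ultimately show ?thesis by (simp add: connected_iff_closed)
qed

section \<open>Blocks and components of induced subgraphs\<close>

lemma graph_induce:
  assumes "graph G" "S \<subseteq> verts G"
  shows "graph (G \<restriction> S)"
proof -
  interpret graph G by fact
  interpret H: digraph "G \<restriction> S"
    by (rule digraph_subgraph) (rule subgraph_induce_subgraphI[OF assms(2)])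
  have "symmetric (G \<restriction> S)"
    using sym_arcs unfolding symmetric_conv by fastforce
  then show ?thesis by (rule H.graphI)
qed

lemma subgraph_induce:
  assumes "verts H \<subseteq> S" "subgraph H G"
  shows "subgraph H (G \<restriction> S)"
proof -
  have H: "wf_digraph H" "wf_digraph G" "compatible G H" "arcs H \<subseteq> arcs G"
    using assms(2) by (auto simp: subgraph_def)
  then have "tail G e \<in> S" "head G e \<in> S" if "e \<in> arcs H" for e
    using that assms(1) by (auto simp: compatible_def wf_digraph_def)
  then show ?thesis
    using H assms(1) by (auto simp: subgraph_def compatible_def wf_digraph.wellformed_induce_subgraph)
qed

text \<open>Common to blocks and components. If \<open>K\<close> is not maximal in \<open>G\<close>,
  some larger \<open>K'\<close> with \<open>P\<close> is not inside \<open>S\<close>, hence lies in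
  \<open>T\<close> and drags \<open>K\<close> into the overlap.\<close>

lemma max_subgraph_induce:
  assumes "wf_digraph G" "S \<subseteq> verts G"
    and within: "\<And>K. subgraph K G \<Longrightarrow> P K \<Longrightarrow> verts K \<subseteq> S \<or> verts K \<subseteq> T"
    and K: "pre_digraph.max_subgraph (G \<restriction> S) P K"
  shows "pre_digraph.max_subgraph G P K \<or> verts K \<subseteq> S \<inter> T"
proof -
  interpret wf_digraph G by fact
  have KS: "subgraph K (G \<restriction> S)" "P K"
      and max: "\<And>K'. \<lbrakk>subgraph K K'; subgraph K' (G \<restriction> S); P K'\<rbrakk> \<Longrightarrow> K' = K"
    using K by (auto simp: pre_digraph.max_subgraph_def)
  have KG: "subgraph K G" using KS(1) subgraph_induce_subgraphI[OF assms(2)] by (rule subgraph_trans)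
  have vK: "verts K \<subseteq> S" using KS(1) by (auto simp: subgraph_def)
  have "K' = K \<or> verts K \<subseteq> T" if K': "subgraph K K'" "subgraph K' G" "P K'" for K'
  proof (cases "verts K' \<subseteq> S")
    case True
    then have "subgraph K' (G \<restriction> S)" using K'(2) by (rule subgraph_induce)
    then show ?thesis using max K' by blast
  next
    case False
    then have "verts K' \<subseteq> T" using within K' by blast
    then show ?thesis using K'(1) by (auto simp: subgraph_def)
  qed
  then show ?thesis using KG KS(2) vK by (auto simp: pre_digraph.max_subgraph_def)
qed

text \<open>Connected subgraphs without a cut vertex stay on one side, so only a block lying in the
  overlap can lose maximality. That case is kept as an alternative and not refuted, since one-vertex
  graphs are ideally choosable anyway.\<close>

lemma block_induce:
  assumes "graph G" "separation G S T" "S \<inter> T = {v}" "block (G \<restriction> S) B"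
  shows "block G B \<or> verts B = {v}"
proof -
  interpret graph G by fact
  have B: "graph B" "Digraph_Component.connected B"
    using assms(4) by (auto simp: block_def pre_digraph.max_subgraph_def)
  have "block G B \<or> verts B \<subseteq> S \<inter> T"
    unfolding block_def
  proof (rule max_subgraph_induce)
    show "S \<subseteq> verts G" using assms(2) by (auto simp: separation_def)
    show "verts K \<subseteq> S \<or> verts K \<subseteq> T"
      if "subgraph K G" "graph K \<and> Digraph_Component.connected K \<and> (\<nexists>v. cut_vertex K v)" for K
      using no_cut_vertex_subgraph_within[OF that(1) _ _ assms(2,3)] that(2) by blast
  qed (use assms(4) wf_digraph in \<open>auto simp: block_def\<close>)
  moreover have "verts B \<noteq> {}" using B by (simp add: connected_def strongly_connected_def)
  ultimately show ?thesis using assms(3) by auto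
qed

lemma connected_component_induce:
  assumes "graph G" "separation G S T" "S \<inter> T = {}" "connected_component (G \<restriction> S) C"
  shows "connected_component G C"
proof -
  interpret graph G by fact
  have C: "graph C" "Digraph_Component.connected C"
    using assms(4) by (auto simp: connected_component_def pre_digraph.max_subgraph_def)
  have "connected_component G C \<or> verts C \<subseteq> S \<inter> T"
    unfolding connected_component_def
  proof (rule max_subgraph_induce)
    show "S \<subseteq> verts G" using assms(2) by (auto simp: separation_def)
    show "verts K \<subseteq> S \<or> verts K \<subseteq> T"
      if "subgraph K G" "graph K \<and> Digraph_Component.connected K" for K
      using connected_subgraph_within that assms(2,3) by blast
  qed (use assms(4) wf_digraph in \<open>auto simp: connected_component_def\<close>)
  \<comment> \<open>Components are nonempty, so none fits into the empty overlap.\<close>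
  moreover have "verts C \<noteq> {}" using C by (simp add: connected_def strongly_connected_def)
  ultimately show ?thesis using assms(3) by auto
qed

lemma max_subgraph_self:
  assumes "wf_digraph G" "P G"
  shows "pre_digraph.max_subgraph G P G"
proof -
  interpret wf_digraph G by fact
  have "H = G" if "subgraph G H" "subgraph H G" for H
    using that by (auto simp: subgraph_def compatible_def)
  then show ?thesis
    using assms(2) subgraph_refl by (auto simp: max_subgraph_def)
qed

section \<open>Gluing list colorings\<close>

lemma list_assignment_induce:
  "list_assignment G l k L \<Longrightarrow> S \<subseteq> verts G \<Longrightarrow> list_assignment (G \<restriction> S) l k L"
  by (auto simp: list_assignment_def)

lemma list_coloring_glue:
  assumes "separation G S T" "list_coloring (G \<restriction> S) L c" "list_coloring (G \<restriction> T) L d"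
    and "\<And>x. x \<in> S \<inter> T \<Longrightarrow> c x = d x"
  shows "list_coloring G L (\<lambda>x. if x \<in> S then c x else d x)" (is "list_coloring G L ?f")
proof -
  have S: "?f x = c x" if "x \<in> S" for x using that by simp
  \<comment> \<open>Agreement on the overlap lets \<open>?f\<close> be read as \<open>d\<close> on
    all of \<open>T\<close>, so arcs inside \<open>T\<close> are governed by \<open>d\<close>
    alone.\<close>
  have T: "?f x = d x" if "x \<in> T" for x using that assms(4) by simp
  have "?f (tail G e) \<noteq> ?f (head G e)" if e: "e \<in> arcs G" for e
  proof -
    consider "tail G e \<in> S" "head G e \<in> S" | "tail G e \<in> T" "head G e \<in> T"
      using assms(1) e by (auto simp: separation_def)
    then show ?thesis
    proof cases
      case 1
      with e assms(2) show ?thesis by (auto simp: S list_coloring_def proper_coloring_def)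
    next
      case 2
      with e assms(3) show ?thesis
        unfolding T[OF 2(1)] T[OF 2(2)] by (auto simp: list_coloring_def proper_coloring_def)
    qed
  qed
  moreover have "?f x \<in> L x" if "x \<in> verts G" for x
    using that assms(1-3) by (auto simp: separation_def list_coloring_def)
  ultimately show ?thesis by (simp add: list_coloring_def proper_coloring_def)
qed

text \<open>The coloring \<open>c\<close> already fixes the color of the shared vertex
  \<open>v\<close>; ideal choosability of the other side supplies a coloring with that very color.
  The result keeps \<open>c\<close> on \<open>S\<close>, so a color prescribed there
  survives.\<close>

lemma list_coloring_extend:
  assumes "separation G S T" "S \<inter> T = {v}" "list_assignment G l k L"
    and "list_coloring (G \<restriction> S) L c" "ideally_lk_choosable l k (G \<restriction> T)"
  obtains f where "list_coloring G L f" "\<And>x. x \<in> S \<Longrightarrow> f x = c x"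
proof -
  have "list_assignment (G \<restriction> T) l k L"
    using assms(1,3) by (intro list_assignment_induce) (auto simp: separation_def)
  moreover have "c v \<in> L v" "v \<in> verts (G \<restriction> T)"
    using assms(2,4) by (auto simp: list_coloring_def)
  ultimately obtain d where d: "list_coloring (G \<restriction> T) L d" "d v = c v"
    using assms(5) unfolding ideally_lk_choosable_def by blast
  have "list_coloring G L (\<lambda>x. if x \<in> S then c x else d x)"
    using assms(1,2,4) d by (intro list_coloring_glue[where T = T]) auto
  then show ?thesis using that by simp
qed

text \<open>Only the side colored second has to accept a prescribed color, hence the asymmetric
  hypotheses.\<close>

lemma lk_choosable_separation:
  assumes "separation G S T" "S \<inter> T = {v}"
    and "lk_choosable l k (G \<restriction> S)" "ideally_lk_choosable l k (G \<restriction> T)"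
  shows "lk_choosable l k G"
  unfolding lk_choosable_def
proof (intro allI impI)
  fix L assume L: "list_assignment G l k L"
  then have "list_assignment (G \<restriction> S) l k L"
    using assms(1) by (intro list_assignment_induce) (auto simp: separation_def)
  then obtain c where "list_coloring (G \<restriction> S) L c"
    using assms(3) unfolding lk_choosable_def by blast
  then show "\<exists>f. list_coloring G L f"
    using list_coloring_extend[OF assms(1,2) L _ assms(4)] by blast
qed

lemma ideally_lk_choosable_separation:
  assumes "separation G S T" "S \<inter> T = {v}"
    and "ideally_lk_choosable l k (G \<restriction> S)" "ideally_lk_choosable l k (G \<restriction> T)"
  shows "ideally_lk_choosable l k G"
  unfolding ideally_lk_choosable_def
proof (intro allI impI ballI)
  fix L v0 c0 assume L: "list_assignment G l k L" and v0: "v0 \<in> verts G" and c0: "c0 \<in> L v0"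
  \<comment> \<open>\<open>A\<close> is the side that contains \<open>v0\<close>: it is colored
    first with \<open>v0\<close> prescribed, and the other side only has to match at
    \<open>v\<close>. Both \<open>S\<close> and \<open>T\<close> can take this role.\<close>
  have extend: "\<exists>f. list_coloring G L f \<and> f v0 = c0"
    if sep: "separation G A B" "A \<inter> B = {v}" and v0: "v0 \<in> A"
      and A: "ideally_lk_choosable l k (G \<restriction> A)" and B: "ideally_lk_choosable l k (G \<restriction> B)" for A B
  proof -
    have "list_assignment (G \<restriction> A) l k L"
      using sep(1) L by (intro list_assignment_induce) (auto simp: separation_def)
    then obtain c where c: "list_coloring (G \<restriction> A) L c" "c v0 = c0"
      using A v0 c0 unfolding ideally_lk_choosable_def by fastforce
    obtain f where "list_coloring G L f" "\<And>x. x \<in> A \<Longrightarrow> f x = c x"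
      using list_coloring_extend[OF sep L c(1) B] by blast
    with c(2) v0 show ?thesis by auto
  qed
  have "v0 \<in> S \<or> v0 \<in> T" using v0 assms(1) by (auto simp: separation_def)
  then show "\<exists>f. list_coloring G L f \<and> f v0 = c0"
    using extend[of S T] extend[of T S] assms by (auto simp: separation_commute Int_commute)
qed

lemma ideally_lk_choosable_imp_lk_choosable:
  assumes "ideally_lk_choosable l k G" "1 \<le> l" "verts G \<noteq> {}"
  shows "lk_choosable l k G"
  unfolding lk_choosable_def
proof (intro allI impI)
  fix L assume L: "list_assignment G l k L"
  obtain v where v: "v \<in> verts G" using assms(3) by blast
  then have "card (L v) = l" using L by (auto simp: list_assignment_def)
  \<comment> \<open>Here \<open>1 \<le> l\<close> is essential: for \<open>l = 0\<close> no list
    offers a color to prescribe, and ideal choosability is vacuous.\<close>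
  then have "L v \<noteq> {}" using assms(2) by auto
  then show "\<exists>c. list_coloring G L c"
    using assms(1) L v unfolding ideally_lk_choosable_def by blast
qed

lemma ideally_lk_choosable_singleton:
  assumes "graph G" "verts G = {v}"
  shows "ideally_lk_choosable l k G"
proof -
  interpret graph G by fact
  have "arcs G = {}"
    using no_loops tail_in_verts head_in_verts assms(2) by (metis all_not_in_conv singletonD)
  then show ?thesis
    using assms(2) by (auto simp: ideally_lk_choosable_def list_coloring_def proper_coloring_def)
qed

section \<open>Induction over blocks\<close>

lemma block_props:
  "block G B \<Longrightarrow> subgraph B G \<and> graph B \<and> Digraph_Component.connected B"
  by (simp add: block_def pre_digraph.max_subgraph_def)

lemma block_self:
  assumes "graph G" "Digraph_Component.connected G" "\<nexists>v. cut_vertex G v"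
  shows "block G G"
  using assms unfolding block_def
  by (intro max_subgraph_self) (auto simp: graph_def digraph_def fin_digraph_def)

lemma ideally_lk_choosable_blocks:
  assumes "graph G" "Digraph_Component.connected G"
    and "\<And>B. block G B \<Longrightarrow> ideally_lk_choosable l k B"
  shows "ideally_lk_choosable l k G"
  using assms
proof (induction "card (verts G)" arbitrary: G rule: less_induct)
  case less
  interpret graph G by fact
  show ?case
  proof (cases "\<exists>v. cut_vertex G v")
    case False
    then show ?thesis using block_self less.prems by blast
  next
    case True
    then obtain v where "cut_vertex G v" by blast
    then obtain S T where ST: "separation G S T" "S \<inter> T = {v}" "S \<subset> verts G" "T \<subset> verts G"
      using cut_vertex_separation[OF wf_digraph] by blast
    have TS: "separation G T S" "T \<inter> S = {v}" using ST by (auto simp: separation_commute)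
    have part: "ideally_lk_choosable l k (G \<restriction> A)"
      if A: "separation G A B" "A \<inter> B = {v}" "A \<subset> verts G" for A B
    proof (rule less.hyps)
      show "card (verts (G \<restriction> A)) < card (verts G)" using A(3) by (simp add: psubset_card_mono)
      show "graph (G \<restriction> A)" using A(3) less.prems(1) by (intro graph_induce) auto
      show "Digraph_Component.connected (G \<restriction> A)"
        using connected_induce_separation[OF wf_digraph less.prems(2) A(1,2)] .
      show "ideally_lk_choosable l k K" if K: "block (G \<restriction> A) K" for K
        using block_induce[OF less.prems(1) A(1,2) K]
      proof
        \<comment> \<open>\<open>K\<close> may fail to be a block of \<open>G\<close> here, but a
          single vertex takes any prescribed color.\<close>
        assume "verts K = {v}"
        with block_props[OF K] show ?thesis by (blast intro: ideally_lk_choosable_singleton)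
      qed (rule less.prems(3))
    qed
    show ?thesis
      using ideally_lk_choosable_separation[OF ST(1,2)] part[OF ST(1-3)] part[OF TS ST(4)] by blast
  qed
qed

text \<open>
  \<open>B0\<close> need not be a block of \<open>G\<close>: this is what lets the induction hypothesis apply to the part
  containing the exceptional block without showing that it is a block of that part.
\<close>

lemma lk_choosable_blocks:
  assumes "graph G" "Digraph_Component.connected G" "1 \<le> l" "lk_choosable l k B0"
    and "\<And>B. block G B \<Longrightarrow> B \<noteq> B0 \<Longrightarrow> ideally_lk_choosable l k B"
  shows "lk_choosable l k G"
  using assms
proof (induction "card (verts G)" arbitrary: G rule: less_induct)
  case less
  interpret graph G by fact
  show ?case
  proof (cases "\<exists>v. cut_vertex G v")
    case False
    \<comment> \<open>Without a cut vertex \<open>G\<close> is its own block: either it is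
      \<open>B0\<close>, or it is ideally choosable and nonempty, hence choosable.\<close>
    then have "block G G" using block_self less.prems(1,2) by blast
    moreover have "verts G \<noteq> {}" using less.prems(2) by (simp add: connected_def strongly_connected_def)
    ultimately show ?thesis
      using less.prems(3-5) ideally_lk_choosable_imp_lk_choosable by blast
  next
    case True
    then obtain v where "cut_vertex G v" by blast
    then obtain S T where ST: "separation G S T" "S \<inter> T = {v}" "S \<subset> verts G" "T \<subset> verts G"
      using cut_vertex_separation[OF wf_digraph] by blast
    \<comment> \<open>Only \<open>B0\<close> can fail to be ideally choosable among the blocks of
      either part.\<close>
    have bl: "ideally_lk_choosable l k K \<or> K = B0"
      if K: "block (G \<restriction> A) K" and A: "separation G A B" "A \<inter> B = {v}" for A B K
      using block_induce[OF less.prems(1) A K]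
    proof
      assume "verts K = {v}"
      with block_props[OF K] show ?thesis by (blast intro: ideally_lk_choosable_singleton)
    qed (use less.prems(5) in blast)
    \<comment> \<open>\<open>A\<close> is colored first and may contain \<open>B0\<close>; all
      blocks of \<open>B\<close> are ideally choosable, so \<open>B\<close> can be colored
      second.\<close>
    have glue: "lk_choosable l k G"
      if A: "separation G A B" "A \<inter> B = {v}" "A \<subset> verts G" "B \<subset> verts G"
        and ideal: "\<And>K. block (G \<restriction> B) K \<Longrightarrow> ideally_lk_choosable l k K" for A B
    proof (rule lk_choosable_separation[OF A(1,2)])
      show "lk_choosable l k (G \<restriction> A)"
      proof (rule less.hyps)
        show "card (verts (G \<restriction> A)) < card (verts G)" using A(3) by (simp add: psubset_card_mono)
        show "graph (G \<restriction> A)" using A(3) less.prems(1) by (intro graph_induce) auto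
        show "Digraph_Component.connected (G \<restriction> A)"
          using connected_induce_separation[OF wf_digraph less.prems(2) A(1,2)] .
        show "ideally_lk_choosable l k K" if "block (G \<restriction> A) K" "K \<noteq> B0" for K
          using bl[OF that(1) A(1,2)] that(2) by blast
      qed fact+
      show "ideally_lk_choosable l k (G \<restriction> B)"
      proof (rule ideally_lk_choosable_blocks[OF _ _ ideal])
        show "graph (G \<restriction> B)" using A(4) less.prems(1) by (intro graph_induce) auto
        show "Digraph_Component.connected (G \<restriction> B)"
          using A(1,2) by (intro connected_induce_separation[OF wf_digraph less.prems(2), of B A v])
            (auto simp: separation_commute)
      qed
    qed
    have TS: "separation G T S" "T \<inter> S = {v}" using ST by (auto simp: separation_commute)
    \<comment> \<open>If all blocks on the side \<open>T\<close> are ideally choosable,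
      \<open>T\<close> goes second. Otherwise \<open>B0\<close> is a block of that side, and the
      roles are exchanged.\<close>
    show ?thesis
    proof (cases "\<forall>K. block (G \<restriction> T) K \<longrightarrow> ideally_lk_choosable l k K")
      case True
      then show ?thesis using glue[OF ST] by blast
    next
      case False
      then obtain K where K: "block (G \<restriction> T) K" "\<not> ideally_lk_choosable l k K" by blast
      then have KB: "K = B0" using bl TS by blast
      \<comment> \<open>A bad block on the side \<open>S\<close> would also be \<open>B0\<close>, so
        the same subgraph would lie on both sides, hence on \<open>{v}\<close> alone; but a
        one-vertex graph is ideally choosable.\<close>
      have "ideally_lk_choosable l k K'" if K': "block (G \<restriction> S) K'" for K'
      proof (rule ccontr)
        assume "\<not> ?thesis"
        then have "K' = K" using bl[OF K' ST(1,2)] KB by blast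
        then have "verts K \<subseteq> S \<inter> T" "graph K" "verts K \<noteq> {}"
          using block_props[OF K(1)] block_props[OF K']
          by (auto simp: connected_def strongly_connected_def dest!: subgraph_imp_subverts)
        then have "verts K = {v}" using ST(2) by auto
        with \<open>graph K\<close> have "ideally_lk_choosable l k K" by (rule ideally_lk_choosable_singleton)
        with K(2) show False by (rule notE)
      qed
      then show ?thesis using glue[OF TS ST(4,3)] by blast
    qed
  qed
qed

section \<open>Passing from components to the whole graph\<close>

text \<open>With disjoint sides no vertex is shared, so any two colorings of the sides fit together
  and plain choosability suffices.\<close>

lemma lk_choosable_components:
  assumes "graph G" "\<And>C. connected_component G C \<Longrightarrow> lk_choosable l k C"
  shows "lk_choosable l k G"
  using assms
proof (induction "card (verts G)" arbitrary: G rule: less_induct)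
  case less
  interpret graph G by fact
  consider "verts G = {}" | "Digraph_Component.connected G"
    | "verts G \<noteq> {}" "\<not> Digraph_Component.connected G" by blast
  then show ?case
  proof cases
    \<comment> \<open>The empty graph is not connected, yet cannot be split into nonempty sides, so
      it is colored directly.\<close>
    case 1
    then have "arcs G = {}" using tail_in_verts by blast
    with 1 show ?thesis by (simp add: lk_choosable_def list_coloring_def proper_coloring_def)
  next
    case 2
    then have "connected_component G G"
      unfolding connected_component_def
      using less.prems(1) by (intro max_subgraph_self wf_digraph) auto
    then show ?thesis by (rule less.prems(2))
  next
    case 3
    then obtain S T where ST: "separation G S T" "S \<inter> T = {}" "S \<noteq> {}" "T \<noteq> {}"
      using not_connected_separation[OF wf_digraph] by blast
    have un: "S \<union> T = verts G" using ST(1) by (simp add: separation_def)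
    have part: "lk_choosable l k (G \<restriction> A)"
      if A: "separation G A B" "A \<inter> B = {}" "A \<subset> verts G" for A B
    proof (rule less.hyps)
      show "card (verts (G \<restriction> A)) < card (verts G)" using A(3) by (simp add: psubset_card_mono)
      show "graph (G \<restriction> A)" using A(3) less.prems(1) by (intro graph_induce) auto
      show "lk_choosable l k C" if "connected_component (G \<restriction> A) C" for C
        using connected_component_induce[OF less.prems(1) A(1,2) that] by (rule less.prems(2))
    qed
    have ps: "S \<subset> verts G" "T \<subset> verts G" using ST un by blast+
    have parts: "lk_choosable l k (G \<restriction> S)" "lk_choosable l k (G \<restriction> T)"
      using part[of S T] part[of T S] ST ps by (auto simp: separation_commute Int_commute)
    show ?thesis
      unfolding lk_choosable_def
    proof (intro allI impI)
      fix L assume "list_assignment G l k L"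
      then have "list_assignment (G \<restriction> S) l k L" "list_assignment (G \<restriction> T) l k L"
        using ps by (auto intro: list_assignment_induce)
      then obtain c d where "list_coloring (G \<restriction> S) L c" "list_coloring (G \<restriction> T) L d"
        using parts unfolding lk_choosable_def by blast
      then show "\<exists>f. list_coloring G L f"
        using list_coloring_glue[OF ST(1)] ST(2) by blast
    qed
  qed
qed

text \<open>Core of both claims for one fixed \<open>k\<close>; the claim about
  \<open>choosable\<close> results from applying it to every number of colors that is at least
  \<open>l\<close>.\<close>

lemma lk_choosable_component_blocks:
  assumes "graph G" "1 \<le> l"
    and "\<And>C. connected_component G C \<Longrightarrow>
      \<exists>B0. lk_choosable l k B0 \<and> (\<forall>B. block C B \<and> B \<noteq> B0 \<longrightarrow> ideally_lk_choosable l k B)"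
  shows "lk_choosable l k G"
proof (rule lk_choosable_components[OF assms(1)])
  fix C assume C: "connected_component G C"
  then have "graph C" "Digraph_Component.connected C"
    by (auto simp: connected_component_def pre_digraph.max_subgraph_def)
  then show "lk_choosable l k C" using assms(3)[OF C] lk_choosable_blocks assms(2) by blast
qed

theorem proposition3p1:
  fixes G :: "('a,'b) pre_digraph" and l k :: nat
  assumes "graph G" and "1 \<le> l" and "l \<le> k"
  shows
    "((\<forall>C. connected_component G C \<longrightarrow>
         (\<exists>B0. block C B0 \<and> lk_choosable l k B0 \<and>
            (\<forall>B. block C B \<and> B \<noteq> B0 \<longrightarrow> ideally_lk_choosable l k B)))
        \<longrightarrow> lk_choosable l k G) \<and>
     ((\<forall>C. connected_component G C \<longrightarrow>
         (\<exists>B0. block C B0 \<and> choosable l B0 \<and>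
            (\<forall>B. block C B \<and> B \<noteq> B0 \<longrightarrow> ideally_choosable l B)))
        \<longrightarrow> choosable l G)"
proof (intro conjI impI)
  assume "\<forall>C. connected_component G C \<longrightarrow>
    (\<exists>B0. block C B0 \<and> lk_choosable l k B0 \<and>
      (\<forall>B. block C B \<and> B \<noteq> B0 \<longrightarrow> ideally_lk_choosable l k B))"
  then show "lk_choosable l k G"
    using assms(1,2) by (intro lk_choosable_component_blocks) blast+
next
  assume H: "\<forall>C. connected_component G C \<longrightarrow>
    (\<exists>B0. block C B0 \<and> choosable l B0 \<and>
      (\<forall>B. block C B \<and> B \<noteq> B0 \<longrightarrow> ideally_choosable l B))"
  show "choosable l G"
    unfolding choosable_def
  proof (intro allI impI)
    fix m assume m: "l \<le> m"
    show "lk_choosable l m G"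
    proof (rule lk_choosable_component_blocks[OF assms(1,2)])
      fix C assume "connected_component G C"
      \<comment> \<open>One \<open>B0\<close> serves every number of colors at once, in particular
        \<open>m\<close>.\<close>
      then obtain B0 where "choosable l B0"
          "\<forall>B. block C B \<and> B \<noteq> B0 \<longrightarrow> ideally_choosable l B"
        using H by blast
      with m show "\<exists>B0. lk_choosable l m B0 \<and>
          (\<forall>B. block C B \<and> B \<noteq> B0 \<longrightarrow> ideally_lk_choosable l m B)"
        unfolding choosable_def ideally_choosable_def by blast
    qed
  qed
qed

end
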